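(* If $r>3$ is an integer, then there are no permutation polynomials of $\mathbb{F}_{3^r}$ of the form \[ f(x)=x^6+a_5x^5+a_3x^3+a_2x^2+a_1x \] with $a_1,a_2,a_3,a_5\in\mathbb{F}_{3^r}$ and $a_5\neq 0$.
   Context: A polynomial $f\in\mathbb{F}_q[x]$ is a permutation polynomial of $\mathbb{F}_q$ if $c\mapsto f(c)$ is a permutation of $\mathbb{F}_q$. *)

theory Defs
  imports "HOL-Computational_Algebra.Polynomial" "HOL-Library.Cardinality"
begin

definition permutation_poly :: "'a :: {field, finite} poly \<Rightarrow> bool" where
  "permutation_poly f \<longleftrightarrow> bij (\<lambda>c. poly f c)"

end

theory Submission
  imports Defs "HOL-Computational_Algebra.Primes"
begin

text \<open>
  For a permutation polynomial \<open>f\<close> of the field with \<open>q = 3 ^ r\<close> elements and \<open>0 < k < q - 1\<close>,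
  the sum of \<open>f c ^ k\<close> over the field vanishes, so that the coefficient of \<open>x ^ (q - 1)\<close> in \<open>f ^ k\<close>
  is \<open>0\<close> as long as \<open>deg (f ^ k) < 2 (q - 1)\<close> (Hermite). Take
  \<open>k = 14 + 27 m\<close> and \<open>k = 16 + 27 m\<close> with \<open>m = (3 ^ (r - 4) - 1) / 2\<close>. The degree of \<open>f ^ k\<close>
  exceeds \<open>q - 1\<close> by less than \<open>27\<close>, so only the leading term of \<open>(f ^ m) ^ 27\<close> contributes, and
  the coefficients of \<open>x ^ 80\<close> in \<open>f ^ 14\<close> and \<open>f ^ 16\<close> must vanish. This gives
  \<open>a2 = - a3 * a5 - a5 ^ 4\<close> and \<open>a1 = a3 * a5 ^ 2 - a5 ^ 5\<close>. Then
  \<open>f = h * (h + a1 / a5 ^ 2)\<close> with \<open>h = x * (x + a5) ^ 2\<close>, so that \<open>f (- a5) = f 0\<close>.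
\<close>

section \<open>Power sums over a finite field\<close>

text \<open>Translation by 1 permutes the ring, so it preserves the sum of all elements while adding
  1 to each of them.\<close>

lemma of_nat_CARD_eq_0: "of_nat CARD('a :: {ring_1, finite}) = (0 :: 'a)"
proof -
  have "(\<Sum>x\<in>UNIV. x + 1) = (\<Sum>x\<in>(UNIV :: 'a set). x)"
    by (rule sum.reindex_bij_witness[of _ "\<lambda>x. x - 1" "\<lambda>x. x + 1"]) auto
  then show ?thesis
    by (simp add: sum.distrib)
qed

text \<open>Multiplication by \<open>x\<close> permutes the nonzero elements, hence preserves their
  product.\<close>

lemma finite_field_power_card_minus_one:
  fixes x :: "'a :: {field, finite}"
  assumes "x \<noteq> 0"
  shows "x ^ (CARD('a) - 1) = 1"
proof -
  have "(\<Prod>y\<in>UNIV-{0}. x * y) = x ^ (CARD('a) - 1) * \<Prod>(UNIV-{0})"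
    by (simp add: prod.distrib)
  also have "(\<Prod>y\<in>UNIV-{0}. x * y) = \<Prod>(UNIV-{0})"
    by (rule prod.reindex_bij_witness[of _ "\<lambda>y. y / x" "\<lambda>y. x * y"]) (use assms in auto)
  finally show ?thesis
    by (simp add: prod_zero_iff)
qed

text \<open>For \<open>j > 0\<close>, some nonzero \<open>g\<close> has
  \<open>g ^ j \<noteq> 1\<close>, because a nonzero polynomial of degree at most \<open>j\<close>
  has too few roots. Substituting \<open>g * c\<close> for \<open>c\<close> multiplies the sum by
  \<open>g ^ j\<close>.\<close>

lemma sum_power_finite_field_less:
  assumes "j < CARD('a :: {field, finite}) - 1"
  shows "(\<Sum>c\<in>(UNIV :: 'a set). c ^ j) = 0"
proof (cases "j = 0")
  case True
  then show ?thesis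
    by (simp add: of_nat_CARD_eq_0)
next
  case False
  define p :: "'a poly" where "p = monom 1 j - 1"
  have "coeff p j = 1"
    using False by (simp add: p_def)
  then have "p \<noteq> 0" by auto
  have "degree p \<le> j"
    unfolding p_def by (intro degree_diff_le) (auto simp: degree_monom_le)
  then have card: "card {x. poly p x = 0} < CARD('a) - 1"
    using card_poly_roots_bound[OF \<open>p \<noteq> 0\<close>] assms by linarith
  have "\<exists>g :: 'a. g \<noteq> 0 \<and> g ^ j \<noteq> 1"
  proof (rule ccontr)
    assume "\<not> ?thesis"
    then have "UNIV - {0} \<subseteq> {x. poly p x = 0}"
      by (auto simp: p_def poly_monom)
    then have "card (UNIV - {0 :: 'a}) \<le> card {x. poly p x = 0}"
      by (intro card_mono) auto
    then show False
      using card by (simp add: card_Diff_singleton)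
  qed
  then obtain g :: 'a where g: "g \<noteq> 0" "g ^ j \<noteq> 1" by blast
  have "bij_betw ((*) g) UNIV UNIV"
    by (rule bij_betw_byWitness[where f' = "\<lambda>y. y / g"]) (use g(1) in auto)
  then have "(\<Sum>c\<in>UNIV. c ^ j) = (\<Sum>c\<in>UNIV. (g * c) ^ j)"
    by (rule sum.reindex_bij_betw[symmetric])
  also have "\<dots> = g ^ j * (\<Sum>c\<in>UNIV. c ^ j)"
    by (simp add: power_mult_distrib sum_distrib_left)
  finally have "(g ^ j - 1) * (\<Sum>c\<in>UNIV. c ^ j) = 0"
    by (simp add: left_diff_distrib)
  then show ?thesis
    using g by simp
qed

lemma sum_power_finite_field:
  assumes "j < 2 * (CARD('a :: {field, finite}) - 1)"
  shows "(\<Sum>c\<in>(UNIV :: 'a set). c ^ j) = (if j = CARD('a) - 1 then - 1 else 0)"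
proof -
  let ?n = "CARD('a) - 1"
  consider "j < ?n" | "j = ?n" | "j > ?n" by linarith
  then show ?thesis
  proof cases
    case 1
    then show ?thesis
      by (simp add: sum_power_finite_field_less)
  next
    case 2
    then have pos: "0 < ?n"
      using assms by simp
    \<comment> \<open>Since \<open>0 ^ 0 = 1\<close>, the powers \<open>c ^ ?n\<close> and
      \<open>c ^ 0\<close> differ only at \<open>c = 0\<close>.\<close>
    have "(\<Sum>c\<in>(UNIV :: 'a set). c ^ ?n) = (\<Sum>c\<in>UNIV. c ^ 0 - (if c = 0 then 1 else 0))"
      using pos by (intro sum.cong) (auto simp: finite_field_power_card_minus_one simp del: One_nat_def)
    also have "\<dots> = - 1"
      using sum_power_finite_field_less[OF pos] by (simp add: sum_subtractf)
    finally show ?thesis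
      using 2 by simp
  next
    case 3
    \<comment> \<open>The strict inequality \<open>j > ?n\<close> matters at \<open>c = 0\<close>:
      both exponents must be positive.\<close>
    have "c ^ j = c ^ (j - ?n)" for c :: 'a
    proof (cases "c = 0")
      case False
      have "c ^ j = c ^ (j - ?n) * c ^ ?n"
        using 3 by (simp flip: power_add)
      then show ?thesis
        using False by (simp add: finite_field_power_card_minus_one del: One_nat_def)
    qed (use 3 in \<open>auto simp: power_0_left\<close>)
    moreover have "j - ?n < ?n"
      using 3 assms by linarith
    ultimately show ?thesis
      using 3 by (simp add: sum_power_finite_field_less)
  qed
qed

lemma sum_poly_finite_field:
  fixes p :: "'a :: {field, finite} poly"
  assumes "degree p < 2 * (CARD('a) - 1)"
  shows "(\<Sum>c\<in>UNIV. poly p c) = - coeff p (CARD('a) - 1)"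
proof -
  have "(\<Sum>c\<in>UNIV. poly p c) = (\<Sum>i\<le>degree p. coeff p i * (\<Sum>c\<in>UNIV. c ^ i))"
    unfolding poly_altdef by (subst sum.swap) (simp add: sum_distrib_left)
  also have "\<dots> = (\<Sum>i\<le>degree p. if i = CARD('a) - 1 then - coeff p i else 0)"
    using assms by (intro sum.cong) (auto simp: sum_power_finite_field)
  also have "\<dots> = - coeff p (CARD('a) - 1)"
    by (simp add: coeff_eq_0)
  finally show ?thesis .
qed

section \<open>Hermite's criterion and extraction of coefficients\<close>

lemma Hermite_criterion_coeff:
  fixes f :: "'a :: {field, finite} poly"
  assumes "permutation_poly f" and "k < CARD('a) - 1"
    and "degree f * k < 2 * (CARD('a) - 1)"
  shows "coeff (f ^ k) (CARD('a) - 1) = 0"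
proof -
  have "(\<Sum>c\<in>UNIV. poly (f ^ k) c) = (\<Sum>c\<in>UNIV. poly f c ^ k)"
    by simp
  also have "\<dots> = (\<Sum>c\<in>UNIV. c ^ k)"
    using assms(1) unfolding permutation_poly_def
    by (intro sum.reindex_bij_betw[where g = "\<lambda>c. c ^ k"])
  also have "\<dots> = 0"
    using assms(2) by (rule sum_power_finite_field_less)
  finally show ?thesis
    using sum_poly_finite_field[of "f ^ k"] degree_power_le[of f k] assms(3) by simp
qed

text \<open>Raising to the power \<open>Q\<close> moves the second term of \<open>p\<close> at least \<open>Q\<close> below the leading one.\<close>

lemma coeff_mult_monic_power_CHAR:
  fixes p s :: "'a :: field poly"
  assumes "prime CHAR('a)" and Q: "Q = CHAR('a) ^ n"
    and "lead_coeff p = 1" and "degree s < j + Q"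
  shows "coeff (s * p ^ Q) (j + degree p * Q) = coeff s j"
proof -
  define d where "d = degree p"
  define R where "R = p - monom 1 d"
  have "Q > 0"
    using assms(1) by (simp add: Q prime_gt_0_nat)
  have "p ^ Q = (monom 1 d + R) ^ Q"
    by (simp add: R_def)
  also have "\<dots> = monom 1 (d * Q) + R ^ Q"
    using assms(1) Q by (subst freshmans_dream'[of Q n]) (auto simp: monom_power)
  finally have pQ: "p ^ Q = monom 1 (d * Q) + R ^ Q" .
  have "coeff (s * R ^ Q) (j + d * Q) = 0"
  proof (cases "R = 0")
    case True
    then show ?thesis
      using \<open>Q > 0\<close> by (simp add: power_0_left)
  next
    case False
    have "coeff R i = 0" if "i \<ge> d" for i
      using that assms(3) by (cases "i = d") (auto simp: R_def d_def coeff_eq_0)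
    then have "degree R < d"
      using False by (metis leading_coeff_0_iff not_le)
    then have "degree R * Q + Q \<le> d * Q"
      by (metis Suc_leI add.commute mult_Suc mult_le_mono1)
    then have "degree (s * R ^ Q) < j + d * Q"
      using degree_mult_le[of s "R ^ Q"] degree_power_le[of R Q] assms(4) by linarith
    then show ?thesis
      by (rule coeff_eq_0)
  qed
  then show ?thesis
    by (simp add: pQ distrib_left mult.commute[of s "monom _ _"] coeff_monom_mult flip: d_def)
qed

section \<open>Monic sextics in characteristic 3\<close>

lemma CHAR_eq_three:
  assumes "CARD('a :: {field, finite}) = 3 ^ r"
  shows "CHAR('a) = 3"
proof -
  have "prime CHAR('a)"
    using finite_imp_CHAR_pos[where ?'a = 'a] by (intro prime_CHAR_semidom) auto
  moreover have "CHAR('a) dvd 3 ^ r"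
    using of_nat_CARD_eq_0[where ?'a = 'a] by (simp only: assms of_nat_eq_0_iff_char_dvd)
  ultimately show ?thesis
    using primes_dvd_imp_eq[of "CHAR('a)" 3] prime_dvd_power by auto
qed

lemma coeff_80_eq_0:
  fixes f :: "'a :: {field, finite} poly"
  assumes card: "CARD('a) = 3 ^ r" and "r > 3"
    and f: "degree f = 6" "lead_coeff f = 1" "permutation_poly f"
    and k: "k \<le> 16"
  shows "coeff (f ^ k) 80 = 0"
proof -
  obtain s where s: "r = 4 + s"
    using \<open>r > 3\<close> le_Suc_ex[of 4 r] by auto
  \<comment> \<open>This makes \<open>CARD('a) - 1 = 80 + 6 * 27 * m\<close>, so the leading term of
    \<open>(f ^ m) ^ 27\<close> accounts for all but 80 of the exponent.\<close>
  define m where "m = (3 ^ s - 1) div (2 :: nat)"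
  have "3 ^ s = Suc (2 * m)"
    by (simp add: m_def)
  then have q: "CARD('a) = 81 + 162 * m"
    by (simp add: card s power_add)
  have char: "CHAR('a) = 3"
    by (rule CHAR_eq_three[OF card])
  have "coeff (f ^ (k + 27 * m)) (CARD('a) - 1) = 0"
    using k f by (intro Hermite_criterion_coeff) (auto simp: q)
  also have "f ^ (k + 27 * m) = f ^ k * (f ^ m) ^ 27"
    by (simp add: power_add flip: power_mult) (simp add: mult.commute)
  also have "CARD('a) - 1 = 80 + degree (f ^ m) * 27"
    using f by (subst degree_power_eq) (auto simp: q)
  also have "coeff (f ^ k * (f ^ m) ^ 27) (80 + degree (f ^ m) * 27) = coeff (f ^ k) 80"
  proof (rule coeff_mult_monic_power_CHAR[where n = 3])
    show "lead_coeff (f ^ m) = 1"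
      using f by (simp add: lead_coeff_power)
    \<comment> \<open>The bound on \<open>k\<close> gives degree at most 96.\<close>
    show "degree (f ^ k) < 80 + 27"
      using degree_power_le[of f k] k f by simp
  qed (simp_all add: char)
  finally show ?thesis .
qed

theorem theorem3p17:
  fixes r :: nat
  assumes "CARD('a :: {field, finite}) = 3 ^ r" and "r > 3"
  shows "\<not> (\<exists>(f :: 'a poly) a1 a2 a3 a5.
           f = monom 1 6 + monom a5 5 + monom a3 3 + monom a2 2 + monom a1 1 \<and>
           a5 \<noteq> 0 \<and> permutation_poly f)"
proof
  assume "\<exists>(f :: 'a poly) a1 a2 a3 a5.
           f = monom 1 6 + monom a5 5 + monom a3 3 + monom a2 2 + monom a1 1 \<and>
           a5 \<noteq> 0 \<and> permutation_poly f"
  \<comment> \<open>The letters \<open>a\<close>, \<open>b\<close>, \<open>c\<close>,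
    \<open>e\<close> stand for \<open>a1\<close>, \<open>a2\<close>, \<open>a3\<close>,
    \<open>a5\<close>.\<close>
  then obtain f :: "'a poly" and a b c e where
    f: "f = monom 1 6 + monom e 5 + monom c 3 + monom b 2 + monom a 1"
    and e: "e \<noteq> 0" and perm: "permutation_poly f"
    by blast
  have char: "CHAR('a) = 3"
    by (rule CHAR_eq_three[OF assms(1)])
  have three: "(3 :: 'a) = 0"
    using of_nat_CHAR[where ?'a = 'a] by (simp add: char)
  have fc: "coeff f n = (if n = 6 then 1 else if n = 5 then e else if n = 3 then c
      else if n = 2 then b else if n = 1 then a else 0)" for n
    by (simp add: f)
  have deg: "degree f = 6"
    by (intro antisym degree_le le_degree) (auto simp: fc)
  have lead: "lead_coeff f = 1"
    by (simp add: deg fc)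
  have frob: "f ^ Q = monom 1 (6 * Q) + monom (e ^ Q) (5 * Q) + monom (c ^ Q) (3 * Q)
      + monom (b ^ Q) (2 * Q) + monom (a ^ Q) (1 * Q)" if "Q = 3 ^ n" for Q n
  proof -
    have "prime CHAR('a poly)" "Q = CHAR('a poly) ^ n"
      using that by (simp_all add: char)
    note freshmans_dream'[OF this]
    then show ?thesis
      by (simp add: f monom_power)
  qed
  \<comment> \<open>Peels off one five-term factor at a time; \<open>6 * Q \<le> n\<close> keeps the
    natural subtractions from truncating.\<close>
  have mult: "coeff (f ^ Q * p) n = coeff p (n - 6 * Q) + e ^ Q * coeff p (n - 5 * Q)
      + c ^ Q * coeff p (n - 3 * Q) + b ^ Q * coeff p (n - 2 * Q) + a ^ Q * coeff p (n - Q)"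
    if "Q = 3 ^ m" "6 * Q \<le> n" for Q m n and p :: "'a poly"
    using that(2) unfolding frob[OF that(1)] by (simp add: distrib_right coeff_monom_mult)
  note mult1 = mult[of 1 0, simplified] and mult3 = mult[of 3 1, simplified]
  have f9: "coeff (f ^ 9) n = (if n = 54 then 1 else if n = 45 then e ^ 9 else if n = 27 then c ^ 9
      else if n = 18 then b ^ 9 else if n = 9 then a ^ 9 else 0)" for n
    by (simp add: frob[of 9 2, simplified])

  have "coeff (f ^ 14) 80 = 0"
    using assms deg lead perm by (intro coeff_80_eq_0) auto
  \<comment> \<open>The base 3 digits of the exponent: \<open>14 = 1 + 1 + 3 + 9\<close>, and below
    \<open>16 = 1 + 3 + 3 + 9\<close>.\<close>
  also have "f ^ 14 = f * (f * (f ^ 3 * f ^ 9))"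
    by (simp flip: power_add power_Suc)
  also have "coeff \<dots> 80 = 2 * e ^ 4 + 2 * b + 2 * c * e"
    by (simp add: mult1 mult3 f9 del: power_add_numeral power_add_numeral2) algebra
  finally have E14: "2 * e ^ 4 + 2 * b + 2 * c * e = 0" .
  \<comment> \<open>Division by 2, written as \<open>X = 3 * X - 2 * X\<close>.\<close>
  have "b + c * e + e ^ 4 = 3 * (b + c * e + e ^ 4) - (2 * e ^ 4 + 2 * b + 2 * c * e)"
    by (simp add: algebra_simps)
  also have "\<dots> = 0"
    by (simp only: three E14) simp
  finally have b: "b = - (c * e) - e ^ 4"
    by (simp add: algebra_simps eq_neg_iff_add_eq_0)

  have "coeff (f ^ 16) 80 = 0"
    using assms deg lead perm by (intro coeff_80_eq_0) auto
  also have "f ^ 16 = f * (f ^ 3 * (f ^ 3 * f ^ 9))"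
    by (simp flip: power_add power_Suc)
  also have "coeff \<dots> 80 = 2 * a ^ 3 * e + 2 * b ^ 3 * e ^ 4 + 2 * b ^ 4 + 2 * b * c ^ 3 * e ^ 3
      + e ^ 16 + 2 * b * e ^ 12"
    by (simp add: mult1 mult3 f9 del: power_add_numeral power_add_numeral2) algebra
  finally have E16: "2 * a ^ 3 * e + 2 * b ^ 3 * e ^ 4 + 2 * b ^ 4 + 2 * b * c ^ 3 * e ^ 3
      + e ^ 16 + 2 * b * e ^ 12 = 0" .
  \<comment> \<open>Modulo 3 the left side is minus the sum in \<open>E16\<close>; the factor of 3 is the integral remainder.\<close>
  have "e * (a - c * e ^ 2 + e ^ 5) ^ 3 = 3 * (a ^ 3 * e - a ^ 2 * c * e ^ 3 + a ^ 2 * e ^ 6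
      + a * c ^ 2 * e ^ 5 - 2 * a * c * e ^ 8 + a * e ^ 11
      + c ^ 3 * e ^ 7 + 3 * c ^ 2 * e ^ 10 - c * e ^ 13)
      - (2 * a ^ 3 * e + 2 * b ^ 3 * e ^ 4 + 2 * b ^ 4 + 2 * b * c ^ 3 * e ^ 3
      + e ^ 16 + 2 * b * e ^ 12)"
    unfolding b by algebra
  also have "\<dots> = 0"
    by (simp only: three E16) simp
  finally have "a - c * e ^ 2 + e ^ 5 = 0"
    using e by simp
  then have a: "a = c * e ^ 2 - e ^ 5"
    by (simp add: algebra_simps eq_neg_iff_add_eq_0)
  have "poly f (- e) = e ^ 6 - e * e ^ 5 - c * e ^ 3 + b * e ^ 2 - a * e"
    by (simp add: f poly_monom)
  \<comment> \<open>Only a multiple of 3 survives, so \<open>f\<close> agrees at \<open>- e\<close>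
    and \<open>0\<close>, which are distinct because \<open>e \<noteq> 0\<close>.\<close>
  also have "\<dots> = - (3 * c * e ^ 3)"
    unfolding a b by algebra
  also have "\<dots> = poly f 0"
    by (simp add: three f poly_monom)
  finally show False
    using perm e unfolding permutation_poly_def bij_def inj_def by fastforce
qed

end
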